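(* Let $r\ge 1$ be an integer, let $V=\mathbb{F}_2^{2r}$, and write an element of $V$ as $(x_1,\ldots,x_r,y_1,\ldots,y_r)$. Define $q:V\to\mathbb{F}_2$ by $$q(x_1,\ldots,x_r,y_1,\ldots,y_r)=\sum_{i=1}^r x_iy_i.$$ Let $G=V\times\mathbb{F}_2$ (as an additive group) and $A=\{(x,q(x)):x\in V\}\subseteq G$. Then $|A|=2^{2r}$ and $$A-A=G\setminus\{(0,1)\}.$$ Moreover, $r_A(0,0)=|A|$ and $r_A(d)=\frac{|A|}{2}$ for every $d\in(A-A)\setminus\{(0,0)\}$. Consequently $r_A(d)\ge |A|/2$ for every $d\in A-A$. However, $A-A$ is neither a subgroup of $G$ nor a union of at most three cosets of any common subgroup of $G$ (i.e. there is no subgroup $K\le G$ such that $A-A$ is a union of at most three cosets of $K$).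
   Context: For a finite non-empty subset $A$ of an abelian group $G$, $A-A=\{a-a':a,a'\in A\}$ and $r_A(d)=|\{(a,a')\in A^2: a-a'=d\}|$ for $d\in G$. *)

theory Defs
  imports
    "HOL-Analysis.Finite_Cartesian_Product"
    "HOL-Library.Product_Plus"
    "HOL-Library.Z2"
    "HOL-Algebra.Coset"
begin

definition difference_set :: "'a::ab_group_add set \<Rightarrow> 'a set" where
  "difference_set A = {a - a' | a a'. a \<in> A \<and> a' \<in> A}"

definition rep_count :: "'a::ab_group_add set \<Rightarrow> 'a \<Rightarrow> nat" where
  "rep_count A d = card {(a, a'). a \<in> A \<and> a' \<in> A \<and> a - a' = d}"

text \<open>The additive group of a type, as a multiplicatively written HOL-Algebra structure, so that
  the library's subgroups and cosets apply to it.\<close>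

definition additive_group :: "'a::ab_group_add monoid" where
  "additive_group = \<lparr>carrier = UNIV, mult = (+), one = 0\<rparr>"

text \<open>The field with two elements is the type \<^typ>\<open>bit\<close>. For an index type \<open>'n\<close> with \<open>r\<close> elements,
  a vector of type \<open>bit ^ ('n + 'n)\<close> has the \<open>2r\<close> coordinates \<open>x\<^sub>i = v $ Inl i\<close> and
  \<open>y\<^sub>i = v $ Inr i\<close>.\<close>

definition quad :: "bit ^ ('n::finite + 'n) \<Rightarrow> bit" where
  "quad v = (\<Sum>i\<in>UNIV. v $ Inl i * v $ Inr i)"

definition quad_graph :: "((bit ^ ('n::finite + 'n)) \<times> bit) set" where
  "quad_graph = {(v, quad v) | v. v \<in> UNIV}"

end

theory Submission
  imports Defs
begin

text \<open>For \<open>u \<noteq> 0\<close> the derivative \<open>v \<mapsto> q (v + u) + q v\<close> flips its value when \<open>v\<close> is translated by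
  the basis vector dual to a nonzero coordinate of \<open>u\<close>, so it takes each value on exactly half of
  \<open>V\<close>; for \<open>u = 0\<close> it vanishes. This gives all the representation counts, and \<open>A - A\<close> misses only
  \<open>(0, 1)\<close>. If a union of cosets of \<open>K\<close> misses exactly one point, then \<open>K\<close> is trivial, because
  translation by a nonzero element of \<open>K\<close> would move the missing point into the union. So the
  cosets are singletons, and three of them cannot cover \<open>2\<^bsup>2r+1\<^esup> - 1 \<ge> 7\<close> points.\<close>

text \<open>Otherwise the simplifier turns ring operations on \<^typ>\<open>bit\<close> into bit operations.\<close>

declare add_bit_eq_xor [simp del] mult_bit_eq_and [simp del]

lemma UNIV_bit: "(UNIV :: bit set) = {0, 1}"
  by (auto intro: bit.exhaust)

instance bit :: finite
  by standard (simp add: UNIV_bit)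

lemma add_self_bit [simp]: "(a :: bit) + a = 0"
  by (cases a) simp_all

text \<open>The map \<open>s\<close> sends each fibre of \<open>f\<close> injectively into the other
  one, so the two fibres have equal size, and together they fill the type.\<close>

lemma balanced_bit_function:
  fixes f :: "'a::finite \<Rightarrow> bit"
  assumes "inj s" and "\<And>v. f (s v) = f v + 1"
  shows "2 * card {v. f v = t} = CARD('a)"
proof -
  have le: "card {v. f v = b} \<le> card {v. f v = b + 1}" for b
    by (rule card_inj_on_le[where f = s])
      (use assms in \<open>auto intro: inj_on_subset\<close>)
  \<comment> \<open>The inequality \<open>le\<close> is applied in both directions, since
    \<open>t + 1 + 1 = t\<close>.\<close>
  have "card {v. f v = t + 1} = card {v. f v = t}"
    using le[of t] le[of "t + 1"] by (simp add: add.assoc)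
  moreover have "CARD('a) = card {v. f v = t} + card {v. f v = t + 1}"
  proof -
    have "(UNIV :: 'a set) = {v. f v = t} \<union> {v. f v = t + 1}"
      by (cases t) auto
    moreover have "{v. f v = t} \<inter> {v. f v = t + 1} = {}" by auto
    ultimately show ?thesis by (metis card_Un_disjoint finite)
  qed
  ultimately show ?thesis by simp
qed

lemma quad_add_axis_Inl:
  "quad (v + axis (Inl i) 1) = quad v + v $ Inr i"
proof -
  have "quad (v + axis (Inl i) 1) =
      (\<Sum>j\<in>UNIV. v $ Inl j * v $ Inr j + (if j = i then v $ Inr j else 0))"
    unfolding quad_def by (rule sum.cong) (auto simp: axis_def algebra_simps)
  then show ?thesis by (simp add: sum.distrib quad_def)
qed

lemma quad_add_axis_Inr:
  "quad (v + axis (Inr i) 1) = quad v + v $ Inl i"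
proof -
  have "quad (v + axis (Inr i) 1) =
      (\<Sum>j\<in>UNIV. v $ Inl j * v $ Inr j + (if j = i then v $ Inl j else 0))"
    unfolding quad_def by (rule sum.cong) (auto simp: axis_def algebra_simps)
  then show ?thesis by (simp add: sum.distrib quad_def)
qed

text \<open>Choose \<open>k\<close> with \<open>u $ k = 1\<close> and let \<open>e\<close> be the
  basis vector at the coordinate paired with \<open>k\<close>. Translation by \<open>e\<close> adds
  \<open>(v + u) $ k\<close> to one value of \<open>quad\<close> and \<open>v $ k\<close> to the
  other, and these two sum to \<open>u $ k = 1\<close>.\<close>

lemma quad_derivative_flip:
  fixes u :: "bit ^ ('n::finite + 'n)"
  assumes "u \<noteq> 0"
  obtains e where "\<And>v. quad (v + e + u) + quad (v + e) = quad (v + u) + quad v + 1"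
proof -
  from assms obtain k where k: "u $ k = 1"
    by (auto simp: vec_eq_iff)
  show thesis
  proof (cases k)
    case (Inl i)
    have "quad (v + axis (Inr i) 1 + u) + quad (v + axis (Inr i) 1) = quad (v + u) + quad v + 1" for v
      using k Inl quad_add_axis_Inr[of "v + u" i] quad_add_axis_Inr[of v i]
      by (cases "v $ Inl i") (simp_all add: ac_simps)
    then show thesis by (rule that)
  next
    case (Inr i)
    have "quad (v + axis (Inl i) 1 + u) + quad (v + axis (Inl i) 1) = quad (v + u) + quad v + 1" for v
      using k Inr quad_add_axis_Inl[of "v + u" i] quad_add_axis_Inl[of v i]
      by (cases "v $ Inr i") (simp_all add: ac_simps)
    then show thesis by (rule that)
  qed
qed

lemma card_quad_graph:
  "card (quad_graph :: ((bit ^ ('n::finite + 'n)) \<times> bit) set) = CARD(bit ^ ('n + 'n))"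
proof -
  have "(quad_graph :: ((bit ^ ('n + 'n)) \<times> bit) set) = range (\<lambda>v. (v, quad v))"
    by (auto simp: quad_graph_def)
  moreover have "inj (\<lambda>v :: bit ^ ('n + 'n). (v, quad v))"
    by (simp add: inj_on_def)
  ultimately show ?thesis by (metis card_image)
qed

text \<open>A pair with difference \<open>(u, t)\<close> is determined by the base point
  \<open>v\<close> of its second entry; in characteristic 2 the difference of the two values of
  \<open>quad\<close> is their sum.\<close>

lemma rep_count_quad_graph:
  fixes u :: "bit ^ ('n::finite + 'n)"
  shows "rep_count quad_graph (u, t) = card {v. quad (v + u) + quad v = t}"
proof -
  have "{(a, a'). a \<in> quad_graph \<and> a' \<in> quad_graph \<and> a - a' = (u, t)}
      = (\<lambda>v. ((v + u, quad (v + u)), (v, quad v))) ` {v. quad (v + u) + quad v = t}"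
    by (auto simp: quad_graph_def diff_eq_eq add.commute)
  then show ?thesis
    unfolding rep_count_def by (simp add: card_image inj_on_def)
qed

lemma rep_count_quad_graph_half:
  fixes u :: "bit ^ ('n::finite + 'n)"
  assumes "u \<noteq> 0"
  shows "2 * rep_count quad_graph (u, t) = CARD(bit ^ ('n + 'n))"
proof -
  obtain e where "\<And>v. quad (v + e + u) + quad (v + e) = quad (v + u) + quad v + 1"
    using quad_derivative_flip[OF assms] by blast
  then show ?thesis
    unfolding rep_count_quad_graph
    by (intro balanced_bit_function[where s = "\<lambda>v. v + e"]) simp_all
qed

lemma difference_set_eq_rep_count:
  fixes A :: "'a::{ab_group_add, finite} set"
  shows "difference_set A = {d. rep_count A d \<noteq> 0}"
  by (auto simp: difference_set_def rep_count_def card_eq_0_iff)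

lemma difference_set_quad_graph:
  "difference_set (quad_graph :: ((bit ^ ('n::finite + 'n)) \<times> bit) set) = UNIV - {(0, 1)}"
proof -
  have *: "rep_count (quad_graph :: ((bit ^ ('n + 'n)) \<times> bit) set) (u, t) \<noteq> 0 \<longleftrightarrow> (u, t) \<noteq> (0, 1)"
    for u t
  proof (cases "u = 0")
    case True
    \<comment> \<open>Here the derivative is identically 0, so every \<open>v\<close> is counted for
      \<open>t = 0\<close> and none for \<open>t = 1\<close>.\<close>
    then show ?thesis by (cases t) (simp_all add: rep_count_quad_graph)
  next
    case False
    then show ?thesis using rep_count_quad_graph_half[of u t] by (auto simp del: CARD_vec intro: Nat.gr0I)
  qed
  show ?thesis
    unfolding difference_set_eq_rep_count
  proof (rule Set.set_eqI)
    fix d :: "(bit ^ ('n + 'n)) \<times> bit"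
    show "d \<in> {d. rep_count quad_graph d \<noteq> 0} \<longleftrightarrow> d \<in> UNIV - {(0, 1)}"
      using *[of "fst d" "snd d"] by (simp del: neq0_conv)
  qed
qed

lemma rcosets_additive_group:
  "rcosets\<^bsub>additive_group\<^esub> K = range (\<lambda>g. (\<lambda>h. h + g) ` K)"
  by (auto simp: RCOSETS_def r_coset_def additive_group_def)

text \<open>Left translation by an element of \<open>K\<close> maps each coset \<open>K + g\<close>
  into itself.\<close>

lemma union_of_rcosets_translate:
  fixes K :: "'a::ab_group_add set"
  assumes "subgroup K additive_group" "C \<subseteq> rcosets\<^bsub>additive_group\<^esub> K" "x \<in> \<Union>C" "k \<in> K"
  shows "k + x \<in> \<Union>C"
proof -
  from assms(2,3) obtain g where g: "x \<in> (\<lambda>h. h + g) ` K" "(\<lambda>h. h + g) ` K \<in> C"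
    unfolding rcosets_additive_group by blast
  from assms(1,4) g(1) have "k + x \<in> (\<lambda>h. h + g) ` K"
    using subgroup.m_closed[OF assms(1)] by (auto simp: additive_group_def add.assoc[symmetric])
  with g(2) show ?thesis by blast
qed

lemma complement_of_point_not_few_rcosets:
  fixes p :: "'a::{ab_group_add, finite}"
  assumes K: "subgroup K additive_group" and C: "C \<subseteq> rcosets\<^bsub>additive_group\<^esub> K"
    and U: "\<Union>C = UNIV - {p}"
  shows "CARD('a) \<le> card C + 1"
proof -
  have trivial: "K \<subseteq> {0}"
  proof (rule ccontr)
    assume "\<not> K \<subseteq> {0}"
    then obtain k where k: "k \<in> K" "k \<noteq> 0" by blast
    \<comment> \<open>Being different from \<open>p\<close>, this point is covered; translating it
      by \<open>k\<close> would then cover \<open>p\<close>.\<close>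
    then have "p - k \<in> \<Union>C" using U by simp
    with union_of_rcosets_translate[OF K C this k(1)] U show False by simp
  qed
  \<comment> \<open>Each nonempty member of \<open>C\<close> is now a singleton, and
    \<open>the_elem\<close> recovers its point.\<close>
  have "\<Union>C \<subseteq> the_elem ` C"
  proof
    fix x assume "x \<in> \<Union>C"
    then obtain c where c: "c \<in> C" "x \<in> c" by blast
    with C obtain g where "c = (\<lambda>h. h + g) ` K"
      unfolding rcosets_additive_group by fast
    with trivial c(2) have "c = {x}" by blast
    with c(1) show "x \<in> the_elem ` C" by force
  qed
  then have "card (UNIV - {p}) \<le> card C"
    unfolding U by (meson card_image_le card_mono finite order_trans)
  then show ?thesis by (simp add: card_Diff_singleton)
qed

theorem theorem4p1:
  fixes r :: nat
    and A :: "((bit ^ ('n::finite + 'n)) \<times> bit) set"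
  assumes "r \<ge> 1"
    and "CARD('n) = r"
    and A_def: "A = quad_graph"
  shows "card A = 2 ^ (2 * r)
    \<and> difference_set A = UNIV - {(0, 1)}
    \<and> rep_count A (0, 0) = card A
    \<and> (\<forall>d \<in> difference_set A - {(0, 0)}. real (rep_count A d) = real (card A) / 2)
    \<and> (\<forall>d \<in> difference_set A. real (rep_count A d) \<ge> real (card A) / 2)
    \<and> \<not> subgroup (difference_set A) additive_group
    \<and> \<not> (\<exists>K C. subgroup K additive_group \<and> C \<subseteq> rcosets\<^bsub>additive_group\<^esub> K
          \<and> finite C \<and> card C \<le> 3 \<and> difference_set A = \<Union>C)"
proof -
  have CARD_bit: "CARD(bit) = 2" by (simp add: UNIV_bit)
  have cardV: "CARD(bit ^ ('n + 'n)) = 2 ^ (2 * r)"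
    using assms(2) by (simp add: CARD_bit card_UNIV_sum mult_2)
  have cardA: "card A = 2 ^ (2 * r)"
    using cardV by (simp add: A_def card_quad_graph del: CARD_vec)
  have diff: "difference_set A = UNIV - {(0, 1)}"
    unfolding A_def by (rule difference_set_quad_graph)
  have zero: "rep_count A (0, 0) = card A"
    by (simp add: A_def rep_count_quad_graph card_quad_graph del: CARD_vec)
  have half: "real (rep_count A d) = real (card A) / 2" if "d \<in> difference_set A - {(0, 0)}" for d
  proof -
    obtain u t where d: "d = (u, t)" by (cases d)
    \<comment> \<open>If \<open>u = 0\<close>, then \<open>d\<close> is \<open>(0, 0)\<close>, which
      is excluded, or \<open>(0, 1)\<close>, which is not a difference.\<close>
    with that diff have "u \<noteq> 0" by (cases t) auto
    from rep_count_quad_graph_half[OF this, of t] have "2 * rep_count A d = card A"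
      by (simp add: d A_def card_quad_graph)
    then show ?thesis by linarith
  qed
  have ge_half: "real (rep_count A d) \<ge> real (card A) / 2" if "d \<in> difference_set A" for d
    using half[of d] zero that by (cases "d = (0, 0)") auto
  \<comment> \<open>Since \<open>r \<ge> 1\<close>, the group has at least 8 elements, more than
    three singleton cosets and the missing point.\<close>
  have "2 ^ 2 \<le> (2 :: nat) ^ (2 * r)"
    using assms(1) by (intro power_increasing) auto
  then have big: "CARD((bit ^ ('n + 'n)) \<times> bit) > 4"
    using cardV by (simp add: CARD_bit del: CARD_vec)
  have cosets: "difference_set A \<noteq> \<Union>C"
    if "subgroup K additive_group" "C \<subseteq> rcosets\<^bsub>additive_group\<^esub> K" "card C \<le> 3" for K C
  proof
    assume "difference_set A = \<Union>C"
    with diff have "\<Union>C = UNIV - {(0, 1)}" by simp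
    from complement_of_point_not_few_rcosets[OF that(1,2) this] big that(3) show False by linarith
  qed
  have "\<not> subgroup (difference_set A) additive_group"
  proof
    \<comment> \<open>A subgroup would be its own single coset.\<close>
    assume sub: "subgroup (difference_set A) additive_group"
    have "(\<lambda>h. h + 0) ` difference_set A = difference_set A"
      by simp
    then have "{difference_set A} \<subseteq> rcosets\<^bsub>additive_group\<^esub> (difference_set A)"
      unfolding rcosets_additive_group by blast
    from cosets[OF sub this] show False by simp
  qed
  with cosets show ?thesis
    by (intro conjI ballI notI cardA diff zero half ge_half) blast+
qed

end
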